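(* Let $L, R$ be subsets of a group $G$ such that $(L,R)$ has the $2$S-Cayley property, and let $\Gamma=\mathrm{2SCay}(G;L,R)$. Then $\Gamma$ is a Cayley graph if at least one of the following conditions holds: $$(\delta)\quad (N_G(L^{-1})\cap N_G(L^{-1}R))\,N_G(R)=G,$$ $$(\delta')\quad N_G(L^{-1})\,(N_G(L^{-1}R)\cap N_G(R))=G.$$ In particular, if $G=N_G(R)$ then $\Gamma=\mathrm{Cay}(G,L^{-1}R)$, and if $G=N_G(L)$ then $\Gamma\cong\mathrm{Cay}(G,R^{-1}L)$.
   Context: Let $G$ be a group with identity $e$; for $X\subseteq G$ and $g\in G$ write $X^{-1}=\{x^{-1}: x\in X\}$, $X^g=g^{-1}Xg$, and $XY=\{xy: x\in X, y\in Y\}$. For any subset $H$ of $G$, the normalizer is the subgroup $N_G(H)=\{g\in G: Hg=gH\}$. For non-empty subsets $L,R$ of $G$, the two-sided Cayley graph $\mathrm{2SCay}(G;L,R)$ is the directed graph with vertex set $G$ with an arc from $x$ to $y$ if and only if $y=\ell^{-1}xr$ for some $\ell\in L$, $r\in R$. If the adjacency relation is symmetric, it is regarded as an undirected graph. A pair $(L,R)$ of subsets of $G$ has the $2$S-Cayley property if both $L,R$ are non-empty and: (1) $L^{-1}gR=LgR^{-1}$ for each $g\in G$ (this makes the adjacency relation symmetric); (2) $L^g\cap R=\varnothing$ for each $g\in G$; (3) $(LL^{-1})^g\cap (RR^{-1})=\{e\}$ for each $g\in G$. For a group $H$ and $S\subseteq H$ with $e\notin S$ and $S=S^{-1}$,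 the Cayley graph $\mathrm{Cay}(H,S)$ is the graph with vertex set $H$ such that $(x,y)$ is an arc iff $xy^{-1}\in S$. A graph "is a Cayley graph" if it is isomorphic to $\mathrm{Cay}(H,S)$ for some group $H$ and some such $S$. *)

theory Defs
  imports "HOL-Algebra.Algebra" "Graph_Theory.Graph_Theory"
begin

text \<open>
  Graphs are possibly infinite digraphs without parallel arcs, in the representation
  \<^typ>\<open>'a pair_pre_digraph\<close>; an undirected graph is a digraph whose arc relation is symmetric.
\<close>

definition two_sided_cayley ::
    "('a, 'b) monoid_scheme \<Rightarrow> 'a set \<Rightarrow> 'a set \<Rightarrow> 'a pair_pre_digraph" where
  "two_sided_cayley G L R =
     \<lparr> pverts = carrier G,
       parcs = {(x, y). x \<in> carrier G \<and> y \<in> carrier G \<and>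
                  (\<exists>l\<in>L. \<exists>r\<in>R. y = inv\<^bsub>G\<^esub> l \<otimes>\<^bsub>G\<^esub> x \<otimes>\<^bsub>G\<^esub> r)} \<rparr>"

definition two_sided_cayley_property ::
    "('a, 'b) monoid_scheme \<Rightarrow> 'a set \<Rightarrow> 'a set \<Rightarrow> bool" where
  "two_sided_cayley_property G L R \<longleftrightarrow>
     L \<subseteq> carrier G \<and> R \<subseteq> carrier G \<and> L \<noteq> {} \<and> R \<noteq> {} \<and>
     (\<forall>g\<in>carrier G.
        (set_inv\<^bsub>G\<^esub> L #>\<^bsub>G\<^esub> g) <#>\<^bsub>G\<^esub> R = (L #>\<^bsub>G\<^esub> g) <#>\<^bsub>G\<^esub> set_inv\<^bsub>G\<^esub> R) \<and>
     (\<forall>g\<in>carrier G. (inv\<^bsub>G\<^esub> g <#\<^bsub>G\<^esub> L #>\<^bsub>G\<^esub> g) \<inter> R = {}) \<and>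
     (\<forall>g\<in>carrier G.
        (inv\<^bsub>G\<^esub> g <#\<^bsub>G\<^esub> (L <#>\<^bsub>G\<^esub> set_inv\<^bsub>G\<^esub> L) #>\<^bsub>G\<^esub> g) \<inter> (R <#>\<^bsub>G\<^esub> set_inv\<^bsub>G\<^esub> R) = {\<one>\<^bsub>G\<^esub>})"

definition connection_set :: "('a, 'b) monoid_scheme \<Rightarrow> 'a set \<Rightarrow> bool" where
  "connection_set H S \<longleftrightarrow> S \<subseteq> carrier H \<and> \<one>\<^bsub>H\<^esub> \<notin> S \<and> S = set_inv\<^bsub>H\<^esub> S"

text \<open>This is only meaningful together with \<^term>\<open>connection_set H S\<close>.\<close>

definition cayley_graph :: "('a, 'b) monoid_scheme \<Rightarrow> 'a set \<Rightarrow> 'a pair_pre_digraph" where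
  "cayley_graph H S =
     \<lparr> pverts = carrier H,
       parcs = {(x, y). x \<in> carrier H \<and> y \<in> carrier H \<and> x \<otimes>\<^bsub>H\<^esub> inv\<^bsub>H\<^esub> y \<in> S} \<rparr>"

abbreviation graph_iso :: "'a pair_pre_digraph \<Rightarrow> 'c pair_pre_digraph \<Rightarrow> bool" where
  "graph_iso \<Gamma> \<Delta> \<equiv> digraph_iso (with_proj \<Gamma>) (with_proj \<Delta>)"

text \<open>
  HOL cannot quantify over the element type of the group inside a formula. Taking the group to
  live on the vertex type of the graph loses nothing, see \<open>is_cayley_graphI\<close> below.
\<close>

definition is_cayley_graph :: "'a pair_pre_digraph \<Rightarrow> bool" where
  "is_cayley_graph \<Gamma> \<longleftrightarrow>
     (\<exists>(H :: 'a monoid) S. group H \<and> connection_set H S \<and> graph_iso \<Gamma> (cayley_graph H S))"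

lemma graph_iso_iff:
  assumes A: "parcs A \<subseteq> pverts A \<times> pverts A" and B: "parcs B \<subseteq> pverts B \<times> pverts B"
  shows "graph_iso A B \<longleftrightarrow>
    (\<exists>f. bij_betw f (pverts A) (pverts B) \<and>
      (\<forall>x\<in>pverts A. \<forall>y\<in>pverts A. (x, y) \<in> parcs A \<longleftrightarrow> (f x, f y) \<in> parcs B))"
    (is "?iso \<longleftrightarrow> (\<exists>f. ?P f)")
proof
  assume ?iso
  then obtain h where h: "pre_digraph.digraph_isomorphism (with_proj A) h"
      and eq: "with_proj B = app_iso h (with_proj A)"
    by (auto simp: digraph_iso_def)
  let ?f = "iso_verts h"
  have verts_B: "pverts B = ?f ` pverts A" and arcs_B: "parcs B = iso_arcs h ` parcs A"
    and ends: "iso_tail h = fst" "iso_head h = snd"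
    using eq by (simp_all add: with_proj_def app_iso_def)
  have inj: "inj_on ?f (pverts A)"
    using h by (simp add: pre_digraph.digraph_isomorphism_def)
  have arc: "iso_arcs h e = (?f (fst e), ?f (snd e))" if "e \<in> parcs A" for e
    using h that ends by (auto simp: pre_digraph.digraph_isomorphism_def prod_eq_iff)
  have "(x, y) \<in> parcs A \<longleftrightarrow> (?f x, ?f y) \<in> parcs B"
    if xy: "x \<in> pverts A" "y \<in> pverts A" for x y
  proof
    assume "(x, y) \<in> parcs A"
    then show "(?f x, ?f y) \<in> parcs B"
      using arc arcs_B by force
  next
    assume "(?f x, ?f y) \<in> parcs B"
    then obtain e where e: "e \<in> parcs A" "(?f x, ?f y) = iso_arcs h e"
      using arcs_B by auto
    then have "?f x = ?f (fst e)" "?f y = ?f (snd e)"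
      using arc by auto
    moreover have "fst e \<in> pverts A" "snd e \<in> pverts A"
      using e(1) A by auto
    ultimately have "x = fst e" "y = snd e"
      using inj xy by (auto dest: inj_onD)
    then show "(x, y) \<in> parcs A"
      using e(1) by simp
  qed
  then show "\<exists>f. ?P f"
    using inj verts_B by (auto simp: bij_betw_def)
next
  assume "\<exists>f. ?P f"
  then obtain f where inj: "inj_on f (pverts A)" and verts_B: "pverts B = f ` pverts A"
    and arc: "\<And>x y. x \<in> pverts A \<Longrightarrow> y \<in> pverts A \<Longrightarrow> (x, y) \<in> parcs A \<longleftrightarrow> (f x, f y) \<in> parcs B"
    by (auto simp: bij_betw_def)
  let ?h = "\<lparr>iso_verts = f, iso_arcs = map_prod f f, iso_head = snd, iso_tail = fst\<rparr>"
  have "inj_on (map_prod f f) (parcs A)"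
    using map_prod_inj_on[OF inj inj] A by (rule inj_on_subset)
  moreover have "wf_digraph (with_proj A)"
    using A by unfold_locales auto
  ultimately have "pre_digraph.digraph_isomorphism (with_proj A) ?h"
    using inj by (simp add: pre_digraph.digraph_isomorphism_def)
  moreover have "parcs B = map_prod f f ` parcs A"
  proof
    show "parcs B \<subseteq> map_prod f f ` parcs A"
    proof
      fix e assume e: "e \<in> parcs B"
      then obtain x y where "x \<in> pverts A" "y \<in> pverts A" "e = (f x, f y)"
        using B verts_B by auto
      then show "e \<in> map_prod f f ` parcs A"
        using arc e by force
    qed
    show "map_prod f f ` parcs A \<subseteq> parcs B"
      using A arc by auto
  qed
  then have "with_proj B = app_iso ?h (with_proj A)"
    using verts_B by (simp add: with_proj_def app_iso_def)
  ultimately show ?iso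
    by (auto simp: digraph_iso_def)
qed

lemma is_cayley_graphI:
  fixes \<Gamma> :: "'a pair_pre_digraph" and H :: "('c, 'd) monoid_scheme"
  assumes arcs: "parcs \<Gamma> \<subseteq> pverts \<Gamma> \<times> pverts \<Gamma>"
    and H: "group H" and S: "connection_set H S" and iso: "graph_iso \<Gamma> (cayley_graph H S)"
  shows "is_cayley_graph \<Gamma>"
proof -
  interpret H: group H by (rule H)
  have wf: "parcs (cayley_graph K T) \<subseteq> pverts (cayley_graph K T) \<times> pverts (cayley_graph K T)"
    for K :: "'a monoid" and T
    by (auto simp: cayley_graph_def)
  obtain f where f: "bij_betw f (pverts \<Gamma>) (carrier H)"
    and f_arc: "\<And>x y. x \<in> pverts \<Gamma> \<Longrightarrow> y \<in> pverts \<Gamma> \<Longrightarrow>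
      (x, y) \<in> parcs \<Gamma> \<longleftrightarrow> f x \<otimes>\<^bsub>H\<^esub> inv\<^bsub>H\<^esub> (f y) \<in> S"
  proof -
    have "parcs (cayley_graph H S) \<subseteq> pverts (cayley_graph H S) \<times> pverts (cayley_graph H S)"
      by (auto simp: cayley_graph_def)
    from iso[unfolded graph_iso_iff[OF arcs this]] obtain f
      where "bij_betw f (pverts \<Gamma>) (pverts (cayley_graph H S))"
        "\<forall>x\<in>pverts \<Gamma>. \<forall>y\<in>pverts \<Gamma>. (x, y) \<in> parcs \<Gamma> \<longleftrightarrow> (f x, f y) \<in> parcs (cayley_graph H S)"
      by blast
    then show thesis
      by (intro that[of f]) (auto simp: cayley_graph_def bij_betw_def)
  qed
  define g where "g = the_inv_into (pverts \<Gamma>) f"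
  have g: "bij_betw g (carrier H) (pverts \<Gamma>)"
    unfolding g_def using f by (rule bij_betw_the_inv_into)
  have gf: "g (f x) = x" if "x \<in> pverts \<Gamma>" for x
    using f that by (auto simp: g_def bij_betw_def the_inv_into_f_f)
  have f_in: "f x \<in> carrier H" if "x \<in> pverts \<Gamma>" for x
    using f that by (auto simp: bij_betw_def)
  define K where "K = image_group g H"
  have inj: "inj_on g (carrier H)"
    using g by (simp add: bij_betw_def)
  have K: "group K"
    unfolding K_def using inj by (rule H.inj_imp_image_group_is_group)
  have "g \<in> iso H K"
    unfolding K_def using inj by (rule inj_imp_image_group_iso)
  then interpret g: group_hom H K g
    using H K by (simp add: group_hom_def group_hom_axioms_def iso_def)
  have carrier_K: "carrier K = pverts \<Gamma>"
    using g by (simp add: K_def image_group_carrier bij_betw_def)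
  have S': "S \<subseteq> carrier H" "\<one>\<^bsub>H\<^esub> \<notin> S" "S = set_inv\<^bsub>H\<^esub> S"
    using S by (auto simp: connection_set_def)
  have g_in_S: "g a \<in> g ` S \<longleftrightarrow> a \<in> S" if "a \<in> carrier H" for a
    using inj_on_image_mem_iff[OF inj that S'(1)] .
  have "set_inv\<^bsub>K\<^esub> (g ` S) = g ` (set_inv\<^bsub>H\<^esub> S)"
    using S'(1) by (auto simp: SET_INV_def subset_iff intro!: image_eqI)
  moreover have "g ` S \<subseteq> carrier K"
    using S'(1) by auto
  ultimately have "connection_set K (g ` S)"
    using S'(2,3) g_in_S[of "\<one>\<^bsub>H\<^esub>"] by (simp add: connection_set_def)
  moreover have "graph_iso \<Gamma> (cayley_graph K (g ` S))"
  proof -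
    have "(x, y) \<in> parcs \<Gamma> \<longleftrightarrow> x \<otimes>\<^bsub>K\<^esub> inv\<^bsub>K\<^esub> y \<in> g ` S"
      if xy: "x \<in> pverts \<Gamma>" "y \<in> pverts \<Gamma>" for x y
    proof -
      have "g (f x \<otimes>\<^bsub>H\<^esub> inv\<^bsub>H\<^esub> (f y)) = x \<otimes>\<^bsub>K\<^esub> inv\<^bsub>K\<^esub> y"
        using xy f_in gf by simp
      then show ?thesis
        using f_arc[OF xy] g_in_S[of "f x \<otimes>\<^bsub>H\<^esub> inv\<^bsub>H\<^esub> (f y)"] f_in xy by simp
    qed
    then show ?thesis
      unfolding graph_iso_iff[OF arcs wf]
      by (intro exI[of _ id]) (auto simp: cayley_graph_def carrier_K)
  qed
  ultimately show ?thesis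
    using K by (auto simp: is_cayley_graph_def)
qed

text \<open>
  The library normalizer of a subset is its stabilizer under conjugation; on subsets of the
  carrier it agrees with the definition by \<open>H g = g H\<close>.
\<close>

lemma (in group) normalizer_eq_commuting:
  assumes "H \<subseteq> carrier G"
  shows "normalizer G H = {g \<in> carrier G. H #> g = g <# H}"
proof -
  have "g <# H #> inv g = H \<longleftrightarrow> H #> g = g <# H" if g: "g \<in> carrier G" for g
  proof
    assume "g <# H #> inv g = H"
    then have "H #> g = (g <# H #> inv g) #> g" by simp
    also have "\<dots> = g <# H"
      using g assms by (simp add: coset_mult_assoc l_coset_subset_G)
    finally show "H #> g = g <# H" .
  next
    assume "H #> g = g <# H"
    then show "g <# H #> inv g = H"
      using g assms by (metis coset_mult_assoc coset_mult_one inv_closed r_inv)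
  qed
  then show ?thesis
    using assms by (auto simp: normalizer_def stabilizer_def)
qed

end

theory Submission
  imports Defs
begin

text \<open>
  The out-neighbourhood of a vertex \<open>x\<close> in the two-sided Cayley graph is \<open>L\<inverse>xR\<close>. Write
  \<open>S = L\<inverse>R\<close>. If \<open>x = ab\<close>, where \<open>a\<close> normalizes \<open>L\<inverse>\<close> and \<open>b\<close> normalizes \<open>R\<close>, then \<open>a\<close> can be
  moved out to the left and \<open>b\<close> out to the right, so the neighbourhood is \<open>aSb\<close>
  (\<open>normalizing_factors_move_out\<close>). If moreover \<open>a\<close> normalizes \<open>S\<close>, as in the first
  factorization of \<open>G\<close>, then \<open>aSb = Sx\<close>; if \<open>b\<close> normalizes \<open>S\<close>, as in the second, then
  \<open>aSb = xS\<close>.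

  Hence all neighbourhoods are right translates of \<open>S\<close>, or all are left translates of \<open>S\<close>. Right
  translates are the neighbourhoods in the Cayley graph of \<open>S\<close> on the same group
  (\<open>two_sided_cayley_eq_cayley_graph\<close>), and inversion of the group carries left translates of \<open>S\<close>
  to right translates of \<open>S\<inverse>\<close> (\<open>two_sided_cayley_iso_cayley_graph\<close>). That \<open>S\<close> is closed under
  inversion, so that in particular \<open>R\<inverse>L = S\<inverse> = S\<close>, is the symmetry of the adjacency relation
  read off at the identity, and \<open>e \<notin> S\<close> because \<open>L\<close> and \<open>R\<close> are disjoint. If \<open>R\<close> or \<open>L\<close> is
  normalized by all of \<open>G\<close>, one of the two factorizations holds with a trivial factor.
\<close>

context group
begin

section \<open>Inverses and normalizers of subsets\<close>

lemma set_inv_subset_carrier: "H \<subseteq> carrier G \<Longrightarrow> set_inv H \<subseteq> carrier G"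
  by (auto simp: SET_INV_def)

lemma set_inv_set_inv_mult:
  assumes "L \<subseteq> carrier G" and "R \<subseteq> carrier G"
  shows "set_inv (set_inv L <#> R) = set_inv R <#> L"
proof -
  have "inv (inv l \<otimes> r) = inv r \<otimes> l" if "l \<in> L" "r \<in> R" for l r
    using that assms by (simp add: inv_mult_group subset_iff)
  then show ?thesis
    unfolding SET_INV_def set_mult_def by simp blast
qed

lemma one_in_normalizer: "H \<subseteq> carrier G \<Longrightarrow> \<one> \<in> normalizer G H"
  by (simp add: normalizer_eq_commuting coset_mult_one lcos_mult_one)

text \<open>
  The factorizations involve the normalizer of \<open>L\<inverse>\<close>, while the special case assumes that all of
  \<open>G\<close> normalizes \<open>L\<close>. Conjugation commutes with inversion, so the two conditions agree.
\<close>

lemma normalizer_subset_normalizer_set_inv: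
  assumes H: "H \<subseteq> carrier G"
  shows "normalizer G H \<subseteq> normalizer G (set_inv H)"
proof
  fix g assume "g \<in> normalizer G H"
  then have g: "g \<in> carrier G" and comm: "H #> g = g <# H"
    using H by (auto simp: normalizer_eq_commuting)
  have conj: "g \<otimes> h \<otimes> inv g \<in> H" "inv g \<otimes> h \<otimes> g \<in> H" if h: "h \<in> H" for h
  proof -
    have hG: "h \<in> carrier G" using h H by auto
    have "g \<otimes> h \<in> H #> g"
      unfolding comm using h by (auto simp: l_coset_def)
    then obtain k where k: "k \<in> H" "g \<otimes> h = k \<otimes> g"
      by (auto simp: r_coset_def)
    have "h \<otimes> g \<in> g <# H"
      unfolding comm[symmetric] using h by (auto simp: r_coset_def)
    then obtain m where m: "m \<in> H" "h \<otimes> g = g \<otimes> m"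
      by (auto simp: l_coset_def)
    have kG: "k \<in> carrier G" and mG: "m \<in> carrier G" using k m H by auto
    show "g \<otimes> h \<otimes> inv g \<in> H" using k kG g by (simp add: m_assoc)
    have "inv g \<otimes> h \<otimes> g = inv g \<otimes> (g \<otimes> m)"
      using m(2) g hG by (simp add: m_assoc)
    also have "\<dots> = m"
      using g mG by (simp flip: m_assoc)
    finally show "inv g \<otimes> h \<otimes> g \<in> H"
      using m(1) by simp
  qed
  have "set_inv H #> g = g <# set_inv H"
  proof
    show "set_inv H #> g \<subseteq> g <# set_inv H"
    proof
      fix y assume "y \<in> set_inv H #> g"
      then obtain h where h: "h \<in> H" "y = inv h \<otimes> g"
        by (auto simp: r_coset_def SET_INV_def)
      have "h \<in> carrier G" using h H by auto
      then have "y = g \<otimes> inv (inv g \<otimes> h \<otimes> g)"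
        using h g by (simp add: inv_mult_group flip: m_assoc)
      then show "y \<in> g <# set_inv H"
        using conj(2)[OF h(1)] by (auto simp: l_coset_def SET_INV_def)
    qed
    show "g <# set_inv H \<subseteq> set_inv H #> g"
    proof
      fix y assume "y \<in> g <# set_inv H"
      then obtain h where h: "h \<in> H" "y = g \<otimes> inv h"
        by (auto simp: l_coset_def SET_INV_def)
      have "h \<in> carrier G" using h H by auto
      then have "y = inv (g \<otimes> h \<otimes> inv g) \<otimes> g"
        using h g by (simp add: inv_mult_group m_assoc)
      then show "y \<in> set_inv H #> g"
        using conj(1)[OF h(1)] by (auto simp: r_coset_def SET_INV_def)
    qed
  qed
  then show "g \<in> normalizer G (set_inv H)"
    using g H by (simp add: normalizer_eq_commuting set_inv_subset_carrier)
qed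

section \<open>Neighbourhoods as translates\<close>

text \<open>
  Associativity separates \<open>M(ab)R\<close> into \<open>(Ma)(bR)\<close>, where each factor can be moved past the set
  that it normalizes. In the application \<open>M\<close> is \<open>L\<inverse>\<close>.
\<close>

lemma normalizing_factors_move_out:
  assumes M: "M \<subseteq> carrier G" and R: "R \<subseteq> carrier G"
    and a: "a \<in> normalizer G M" and b: "b \<in> normalizer G R"
  shows "(M #> (a \<otimes> b)) <#> R = a <# (M <#> R) #> b"
proof -
  have aG: "a \<in> carrier G" and Ma: "M #> a = a <# M"
    and bG: "b \<in> carrier G" and Rb: "R #> b = b <# R"
    using a b M R by (auto simp: normalizer_eq_commuting)
  have aM: "a <# M \<subseteq> carrier G"
    using M aG by (rule l_coset_subset_G)
  have "(M #> (a \<otimes> b)) <#> R = ((a <# M) #> b) <#> R"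
    using M aG bG Ma by (simp flip: coset_mult_assoc)
  also have "\<dots> = (a <# M) <#> (R #> b)"
    using aM R bG Rb by (simp add: rcos_assoc_lcos)
  also have "\<dots> = ((a <# M) <#> R) #> b"
    using aM R bG by (simp add: setmult_rcos_assoc)
  also have "(a <# M) <#> R = a <# (M <#> R)"
    using M R aG by (simp add: l_coset_eq_set_mult set_mult_assoc)
  finally show ?thesis .
qed

text \<open>
  For \<open>M = L\<inverse>\<close> the factorization is condition \<open>(\<delta>)\<close>: the left factor \<open>a\<close> of \<open>x = ab\<close> also
  normalizes \<open>S = MR\<close>, so it can be moved through \<open>aSb\<close> to join \<open>b\<close>.
\<close>

lemma neighbourhoods_right_translates:
  assumes M: "M \<subseteq> carrier G" and R: "R \<subseteq> carrier G"
    and factorization: "(normalizer G M \<inter> normalizer G (M <#> R)) <#> normalizer G R = carrier G"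
    and x: "x \<in> carrier G"
  shows "(M #> x) <#> R = (M <#> R) #> x"
proof -
  have S: "M <#> R \<subseteq> carrier G"
    using M R by (rule set_mult_closed)
  obtain a b where a: "a \<in> normalizer G M" "a \<in> normalizer G (M <#> R)"
    and b: "b \<in> normalizer G R" and x_eq: "x = a \<otimes> b"
    using x factorization[symmetric] by (auto simp: set_mult_def)
  have ab: "a \<in> carrier G" "b \<in> carrier G" "(M <#> R) #> a = a <# (M <#> R)"
    using a b R S by (auto simp: normalizer_eq_commuting)
  have "(M #> x) <#> R = a <# (M <#> R) #> b"
    unfolding x_eq by (rule normalizing_factors_move_out[OF M R a(1) b])
  also have "\<dots> = (M <#> R) #> a #> b"
    by (simp only: ab(3))
  also have "\<dots> = (M <#> R) #> x"
    unfolding x_eq by (rule coset_mult_assoc[OF S ab(1,2)])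
  finally show ?thesis .
qed

text \<open>
  Here the factorization is condition \<open>(\<delta>')\<close>: now the right factor \<open>b\<close> normalizes \<open>S\<close> and is
  moved to the left through \<open>aSb\<close> to join \<open>a\<close>.
\<close>

lemma neighbourhoods_left_translates:
  assumes M: "M \<subseteq> carrier G" and R: "R \<subseteq> carrier G"
    and factorization: "normalizer G M <#> (normalizer G (M <#> R) \<inter> normalizer G R) = carrier G"
    and x: "x \<in> carrier G"
  shows "(M #> x) <#> R = x <# (M <#> R)"
proof -
  have S: "M <#> R \<subseteq> carrier G"
    using M R by (rule set_mult_closed)
  obtain a b where a: "a \<in> normalizer G M"
    and b: "b \<in> normalizer G (M <#> R)" "b \<in> normalizer G R" and x_eq: "x = a \<otimes> b"
    using x factorization[symmetric] by (auto simp: set_mult_def)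
  have ab: "a \<in> carrier G" "b \<in> carrier G" "(M <#> R) #> b = b <# (M <#> R)"
    using a b M S by (auto simp: normalizer_eq_commuting)
  have "(M #> x) <#> R = a <# (M <#> R) #> b"
    unfolding x_eq by (rule normalizing_factors_move_out[OF M R a b(2)])
  also have "\<dots> = a <# ((M <#> R) #> b)"
    by (rule coset_assoc[OF ab(1,2) S, symmetric])
  also have "\<dots> = a <# (b <# (M <#> R))"
    by (simp only: ab(3))
  also have "\<dots> = x <# (M <#> R)"
    unfolding x_eq by (rule lcos_m_assoc[OF S ab(1,2)])
  finally show ?thesis .
qed

section \<open>Symmetry and the connection set\<close>

lemma two_sided_cayley_arc_iff:
  assumes "L \<subseteq> carrier G" and "R \<subseteq> carrier G" and "x \<in> carrier G"
  shows "(x, y) \<in> parcs (two_sided_cayley G L R) \<longleftrightarrow> y \<in> (set_inv L #> x) <#> R"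
  using assms
  by (auto simp: two_sided_cayley_def SET_INV_def r_coset_def set_mult_def subset_iff)

text \<open>
  Solving \<open>y = l\<inverse>xr\<close> for \<open>x\<close> gives \<open>x \<in> LyR\<inverse>\<close>, which the first part of the property identifies
  with the neighbourhood of \<open>y\<close>.
\<close>

lemma two_sided_cayley_sym:
  assumes cayley_prop: "two_sided_cayley_property G L R"
    and arc: "(x, y) \<in> parcs (two_sided_cayley G L R)"
  shows "(y, x) \<in> parcs (two_sided_cayley G L R)"
proof -
  have L: "L \<subseteq> carrier G" and R: "R \<subseteq> carrier G"
    using cayley_prop by (auto simp: two_sided_cayley_property_def)
  obtain l r where l: "l \<in> L" and r: "r \<in> R" and y_eq: "y = inv l \<otimes> x \<otimes> r"
    and x: "x \<in> carrier G" and y: "y \<in> carrier G"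
    using arc by (auto simp: two_sided_cayley_def)
  have "l \<in> carrier G" "r \<in> carrier G"
    using l r L R by auto
  then have "x = l \<otimes> y \<otimes> inv r"
    using x unfolding y_eq by (simp add: m_assoc) (simp flip: m_assoc)
  then have "x \<in> (L #> y) <#> set_inv R"
    using l r by (auto simp: r_coset_def set_mult_def SET_INV_def)
  also have "(L #> y) <#> set_inv R = (set_inv L #> y) <#> R"
    using cayley_prop y by (simp add: two_sided_cayley_property_def)
  finally show ?thesis
    using two_sided_cayley_arc_iff[OF L R y] by simp
qed

lemma one_notin_set_inv_mult:
  assumes cayley_prop: "two_sided_cayley_property G L R"
  shows "\<one> \<notin> set_inv L <#> R"
proof
  have L: "L \<subseteq> carrier G" and R: "R \<subseteq> carrier G"
    using cayley_prop by (auto simp: two_sided_cayley_property_def)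
  have disj: "(inv \<one> <# L #> \<one>) \<inter> R = {}"
    using cayley_prop one_closed unfolding two_sided_cayley_property_def by blast
  assume "\<one> \<in> set_inv L <#> R"
  then obtain l r where l: "l \<in> L" and r: "r \<in> R" and eq: "inv l \<otimes> r = \<one>"
    by (force simp: set_mult_def SET_INV_def)
  have "l \<in> carrier G" "r \<in> carrier G"
    using l r L R by auto
  then have "l = r"
    using eq by (metis inv_closed inv_equality inv_inv)
  then show False
    using l r disj L by (simp add: lcos_mult_one coset_mult_one disjoint_iff)
qed

text \<open>
  Each way of writing the neighbourhoods as translates of \<open>S\<close> turns the symmetry of adjacency
  between \<open>e\<close> and \<open>s \<in> S\<close> into \<open>s\<inverse> \<in> S\<close>.
\<close>

lemma connection_set_if_translates:
  assumes cayley_prop: "two_sided_cayley_property G L R"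
    and translates: "(\<forall>x\<in>carrier G. (set_inv L #> x) <#> R = (set_inv L <#> R) #> x) \<or>
      (\<forall>x\<in>carrier G. (set_inv L #> x) <#> R = x <# (set_inv L <#> R))"
  shows "connection_set G (set_inv L <#> R)"
proof -
  let ?S = "set_inv L <#> R"
  have L: "L \<subseteq> carrier G" and R: "R \<subseteq> carrier G"
    using cayley_prop by (auto simp: two_sided_cayley_property_def)
  have S: "?S \<subseteq> carrier G"
    using L R by (simp add: set_mult_closed set_inv_subset_carrier)
  have inv_in: "inv s \<in> ?S" if s: "s \<in> ?S" for s
  proof -
    have sG: "s \<in> carrier G" using s S by auto
    have "(\<one>, s) \<in> parcs (two_sided_cayley G L R)"
      using s L R by (simp add: two_sided_cayley_arc_iff coset_mult_one set_inv_subset_carrier)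
    then have "(s, \<one>) \<in> parcs (two_sided_cayley G L R)"
      by (rule two_sided_cayley_sym[OF cayley_prop])
    then have "\<one> \<in> ?S #> s \<or> \<one> \<in> s <# ?S"
      using translates sG L R by (auto simp: two_sided_cayley_arc_iff)
    then obtain t where t: "t \<in> ?S" "t \<otimes> s = \<one> \<or> s \<otimes> t = \<one>"
      by (auto simp: r_coset_def l_coset_def)
    have "t \<in> carrier G" using t S by auto
    then have "inv s = t"
      using t(2) sG by (metis inv_equality inv_comm)
    then show ?thesis using t by simp
  qed
  have "?S = set_inv ?S"
  proof
    show "set_inv ?S \<subseteq> ?S"
      using inv_in by (auto simp: SET_INV_def)
    show "?S \<subseteq> set_inv ?S"
    proof
      fix s assume s: "s \<in> ?S"
      then have "s = inv (inv s)" using S by auto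
      then show "s \<in> set_inv ?S" using inv_in[OF s] by (auto simp: SET_INV_def)
    qed
  qed
  then show ?thesis
    using S one_notin_set_inv_mult[OF cayley_prop] by (auto simp: connection_set_def)
qed

lemma connection_set_inv_iff:
  assumes "connection_set G S" and "a \<in> carrier G"
  shows "inv a \<in> S \<longleftrightarrow> a \<in> S"
proof -
  have "inv s \<in> S" if "s \<in> S" for s
    using assms(1) that unfolding connection_set_def SET_INV_def by blast
  then show ?thesis
    using assms(2) inv_inv by metis
qed

section \<open>Identification with Cayley graphs\<close>

text \<open>
  The neighbourhood description puts an arc from \<open>x\<close> to \<open>y\<close> when \<open>yx\<inverse> \<in> S\<close>, the Cayley graph when
  \<open>xy\<inverse> \<in> S\<close>. The two agree because \<open>S\<close> is closed under inversion.
\<close>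

lemma two_sided_cayley_eq_cayley_graph:
  assumes cayley_prop: "two_sided_cayley_property G L R"
    and translates: "\<And>x. x \<in> carrier G \<Longrightarrow> (set_inv L #> x) <#> R = (set_inv L <#> R) #> x"
  shows "two_sided_cayley G L R = cayley_graph G (set_inv L <#> R)"
proof -
  let ?S = "set_inv L <#> R"
  have L: "L \<subseteq> carrier G" and R: "R \<subseteq> carrier G"
    using cayley_prop by (auto simp: two_sided_cayley_property_def)
  have conn: "connection_set G ?S"
    using connection_set_if_translates[OF cayley_prop] translates by blast
  have S: "?S \<subseteq> carrier G"
    using conn by (simp add: connection_set_def)
  have arc: "(x, y) \<in> parcs (two_sided_cayley G L R) \<longleftrightarrow> x \<otimes> inv y \<in> ?S"
    if x: "x \<in> carrier G" and y: "y \<in> carrier G" for x y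
  proof -
    have "(x, y) \<in> parcs (two_sided_cayley G L R) \<longleftrightarrow> y \<in> ?S #> x"
      using L R x translates by (simp add: two_sided_cayley_arc_iff)
    also have "\<dots> \<longleftrightarrow> y \<otimes> inv x \<in> ?S"
    proof
      assume "y \<in> ?S #> x"
      then obtain s where "s \<in> ?S" "y = s \<otimes> x" by (auto simp: r_coset_def)
      then show "y \<otimes> inv x \<in> ?S" using x S by (auto simp: m_assoc subset_iff)
    next
      assume "y \<otimes> inv x \<in> ?S"
      moreover have "y = (y \<otimes> inv x) \<otimes> x" using x y by (simp add: m_assoc)
      ultimately show "y \<in> ?S #> x" by (auto simp: r_coset_def)
    qed
    also have "y \<otimes> inv x = inv (x \<otimes> inv y)"
      using x y by (simp add: inv_mult_group)
    also have "inv (x \<otimes> inv y) \<in> ?S \<longleftrightarrow> x \<otimes> inv y \<in> ?S"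
      using conn x y by (simp add: connection_set_inv_iff)
    finally show ?thesis .
  qed
  have "(x, y) \<in> parcs (two_sided_cayley G L R) \<longleftrightarrow> (x, y) \<in> parcs (cayley_graph G ?S)"
    for x y
    using arc[of x y] by (auto simp: two_sided_cayley_def cayley_graph_def)
  then have "parcs (two_sided_cayley G L R) = parcs (cayley_graph G ?S)"
    by (simp add: set_eq_iff)
  then show ?thesis
    by (simp add: two_sided_cayley_def cayley_graph_def)
qed

text \<open>
  Adjacency is now \<open>x\<inverse>y \<in> S\<close>, while the Cayley graph uses quotients on the other side, so the
  isomorphism is inversion rather than the identity.
\<close>

lemma two_sided_cayley_iso_cayley_graph:
  assumes cayley_prop: "two_sided_cayley_property G L R"
    and translates: "\<And>x. x \<in> carrier G \<Longrightarrow> (set_inv L #> x) <#> R = x <# (set_inv L <#> R)"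
  shows "graph_iso (two_sided_cayley G L R) (cayley_graph G (set_inv L <#> R))"
proof -
  let ?S = "set_inv L <#> R"
  have L: "L \<subseteq> carrier G" and R: "R \<subseteq> carrier G"
    using cayley_prop by (auto simp: two_sided_cayley_property_def)
  have S: "?S \<subseteq> carrier G"
    using L R by (simp add: set_mult_closed set_inv_subset_carrier)
  have arc: "(x, y) \<in> parcs (two_sided_cayley G L R) \<longleftrightarrow> inv x \<otimes> y \<in> ?S"
    if x: "x \<in> carrier G" and y: "y \<in> carrier G" for x y
  proof -
    have "(x, y) \<in> parcs (two_sided_cayley G L R) \<longleftrightarrow> y \<in> x <# ?S"
      using L R x translates by (simp add: two_sided_cayley_arc_iff)
    also have "\<dots> \<longleftrightarrow> inv x \<otimes> y \<in> ?S"
    proof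
      assume "y \<in> x <# ?S"
      then obtain s where "s \<in> ?S" "y = x \<otimes> s" by (auto simp: l_coset_def)
      then show "inv x \<otimes> y \<in> ?S" using x S by (auto simp flip: m_assoc simp: subset_iff)
    next
      assume "inv x \<otimes> y \<in> ?S"
      moreover have "y = x \<otimes> (inv x \<otimes> y)" using x y by (simp flip: m_assoc)
      ultimately show "y \<in> x <# ?S" by (auto simp: l_coset_def)
    qed
    finally show ?thesis .
  qed
  have "bij_betw (\<lambda>x. inv x) (carrier G) (carrier G)"
    by (rule bij_betw_byWitness[where f' = "\<lambda>x. inv x"]) auto
  moreover have "parcs (two_sided_cayley G L R)
      \<subseteq> pverts (two_sided_cayley G L R) \<times> pverts (two_sided_cayley G L R)"
    by (auto simp: two_sided_cayley_def)
  moreover have "parcs (cayley_graph G ?S)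
      \<subseteq> pverts (cayley_graph G ?S) \<times> pverts (cayley_graph G ?S)"
    by (auto simp: cayley_graph_def)
  moreover have "pverts (two_sided_cayley G L R) = carrier G"
    by (simp add: two_sided_cayley_def)
  moreover have "(inv x, inv y) \<in> parcs (cayley_graph G ?S) \<longleftrightarrow> inv x \<otimes> y \<in> ?S"
    if "x \<in> carrier G" "y \<in> carrier G" for x y
    using that by (simp add: cayley_graph_def)
  ultimately show ?thesis
    using arc by (subst graph_iso_iff) (auto simp: cayley_graph_def intro!: exI[of _ "\<lambda>x. inv x"])
qed

end

section \<open>Two-sided Cayley graphs that are Cayley graphs\<close>

theorem proposition5p1:
  fixes G :: "('a, 'b) monoid_scheme" (structure) and L R :: "'a set"
  assumes "group G" and "L \<subseteq> carrier G" and "R \<subseteq> carrier G"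
    and "two_sided_cayley_property G L R"
  shows "((normalizer G (set_inv L) \<inter> normalizer G (set_inv L <#> R)) <#> normalizer G R = carrier G \<or>
          normalizer G (set_inv L) <#> (normalizer G (set_inv L <#> R) \<inter> normalizer G R) = carrier G
            \<longrightarrow> is_cayley_graph (two_sided_cayley G L R)) \<and>
         (carrier G = normalizer G R \<longrightarrow>
            connection_set G (set_inv L <#> R) \<and>
            two_sided_cayley G L R = cayley_graph G (set_inv L <#> R)) \<and>
         (carrier G = normalizer G L \<longrightarrow>
            connection_set G (set_inv R <#> L) \<and>
            graph_iso (two_sided_cayley G L R) (cayley_graph G (set_inv R <#> L)))"
proof -
  interpret group G by fact
  note L = assms(2) and R = assms(3) and cayley_prop = assms(4)
  let ?M = "set_inv L" and ?S = "set_inv L <#> R"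
  let ?\<delta> = "(normalizer G ?M \<inter> normalizer G ?S) <#> normalizer G R = carrier G"
  let ?\<delta>' = "normalizer G ?M <#> (normalizer G ?S \<inter> normalizer G R) = carrier G"
  have M: "?M \<subseteq> carrier G"
    using L by (rule set_inv_subset_carrier)
  have S: "?S \<subseteq> carrier G"
    using M R by (rule set_mult_closed)
  have left: "connection_set G ?S \<and> two_sided_cayley G L R = cayley_graph G ?S" if ?\<delta>
    using neighbourhoods_right_translates[OF M R that]
      connection_set_if_translates[OF cayley_prop] two_sided_cayley_eq_cayley_graph[OF cayley_prop] by blast
  have right: "connection_set G ?S \<and> graph_iso (two_sided_cayley G L R) (cayley_graph G ?S)"
    if ?\<delta>'
    using neighbourhoods_left_translates[OF M R that]
      connection_set_if_translates[OF cayley_prop] two_sided_cayley_iso_cayley_graph[OF cayley_prop] by blast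
  have arcs: "parcs (two_sided_cayley G L R)
      \<subseteq> pverts (two_sided_cayley G L R) \<times> pverts (two_sided_cayley G L R)"
    by (auto simp: two_sided_cayley_def)
  have refl: "graph_iso (two_sided_cayley G L R) (two_sided_cayley G L R)"
    unfolding graph_iso_iff[OF arcs arcs] by (rule exI[of _ id]) simp
  have norm_closed: "normalizer G H \<subseteq> carrier G" if "H \<subseteq> carrier G" for H
    using that by (auto simp: normalizer_eq_commuting)
  have cayley: "is_cayley_graph (two_sided_cayley G L R)" if "?\<delta> \<or> ?\<delta>'"
    using that
  proof
    assume ?\<delta>
    from left[OF this] show ?thesis
      using is_cayley_graphI[OF arcs is_group, of ?S] refl by simp
  next
    assume ?\<delta>'
    from right[OF this] show ?thesis
      using is_cayley_graphI[OF arcs is_group, of ?S] by blast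
  qed
  have R_normal: "?\<delta>" if "carrier G = normalizer G R"
  proof
    show "(normalizer G ?M \<inter> normalizer G ?S) <#> normalizer G R \<subseteq> carrier G"
      using norm_closed[OF M] norm_closed[OF R] by (intro set_mult_closed) auto
    show "carrier G \<subseteq> (normalizer G ?M \<inter> normalizer G ?S) <#> normalizer G R"
    proof
      fix x assume "x \<in> carrier G"
      then have "x = \<one> \<otimes> x" "x \<in> normalizer G R" using that by auto
      then show "x \<in> (normalizer G ?M \<inter> normalizer G ?S) <#> normalizer G R"
        using one_in_normalizer[OF M] one_in_normalizer[OF S] unfolding set_mult_def by blast
    qed
  qed
  have L_normal: "?\<delta>'" if "carrier G = normalizer G L"
  proof
    show "normalizer G ?M <#> (normalizer G ?S \<inter> normalizer G R) \<subseteq> carrier G"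
      using norm_closed[OF M] norm_closed[OF R] by (intro set_mult_closed) auto
    show "carrier G \<subseteq> normalizer G ?M <#> (normalizer G ?S \<inter> normalizer G R)"
    proof
      fix x assume "x \<in> carrier G"
      then have "x = x \<otimes> \<one>" "x \<in> normalizer G ?M"
        using that normalizer_subset_normalizer_set_inv[OF L] by auto
      then show "x \<in> normalizer G ?M <#> (normalizer G ?S \<inter> normalizer G R)"
        using one_in_normalizer[OF R] one_in_normalizer[OF S] unfolding set_mult_def by blast
    qed
  qed
  have S_eq: "set_inv R <#> L = ?S" if "connection_set G ?S"
    using that set_inv_set_inv_mult[OF L R] by (simp add: connection_set_def)
  have L_case: "connection_set G (set_inv R <#> L) \<and>
      graph_iso (two_sided_cayley G L R) (cayley_graph G (set_inv R <#> L))"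
    if "carrier G = normalizer G L"
    using right[OF L_normal[OF that]] S_eq by simp
  show ?thesis
    using cayley left[OF R_normal] L_case by blast
qed

end
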